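(* Let $\mathcal{G}\subseteq\mathbb{C}$ be open and let $\{\phi_j\}_{j=1}^\infty$ be a sequence of holomorphic functions $\phi_j:\mathcal{G}\to\mathcal{G}$ such that for every compact disk $\mathcal{K}\subset\mathcal{G}$ $$\sum_{j=1}^\infty \sup_{z\in\mathcal{K}}|\phi_j(z)-z|<\infty .$$ Then the infinite composition $$\Phi(z)=\lim_{n\to\infty}\phi_1(\phi_2(\dots\phi_n(z)\dots))$$ is a holomorphic function taking $\mathcal{G}$ to itself.
   Context: The infinite (inner) composition of $\{\phi_j\}$ is the limit of the functions $\Phi_n=\phi_1\circ\phi_2\circ\cdots\circ\phi_n$, so that $\Phi_{n+1}(z)=\Phi_n(\phi_{n+1}(z))$. Saying that the infinite composition is a holomorphic function means that $\Phi_n$ converges as $n\to\infty$, uniformly on compact subsets of the domain, and the limit is holomorphic. A compact disk is a set $\{z: |z-z_0|\le P\}$ with $P>0$. *)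

theory Defs
  imports "HOL-Complex_Analysis.Complex_Analysis"
begin

text \<open>
  The family is indexed from 1, so \<open>\<phi> 0\<close> is never used:
  \<open>inner_comp \<phi> n = \<phi> 1 \<circ> \<phi> 2 \<circ> \<dots> \<circ> \<phi> n\<close>, with the empty composition the identity.
\<close>

primrec inner_comp :: "(nat \<Rightarrow> complex \<Rightarrow> complex) \<Rightarrow> nat \<Rightarrow> complex \<Rightarrow> complex" where
  "inner_comp \<phi> 0 = id"
| "inner_comp \<phi> (Suc n) = inner_comp \<phi> n \<circ> \<phi> (Suc n)"

definition infinite_comp :: "(nat \<Rightarrow> complex \<Rightarrow> complex) \<Rightarrow> complex \<Rightarrow> complex" where
  "infinite_comp \<phi> z = lim (\<lambda>n. inner_comp \<phi> n z)"

text \<open>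
  The operator \<^const>\<open>lim\<close> is total; genuine convergence of the compositions to
  \<^term>\<open>infinite_comp \<phi>\<close> is the first conjunct below.
\<close>

definition infinite_comp_holomorphic_on ::
    "(nat \<Rightarrow> complex \<Rightarrow> complex) \<Rightarrow> complex set \<Rightarrow> bool" where
  "infinite_comp_holomorphic_on \<phi> G \<longleftrightarrow>
     (\<forall>K. compact K \<and> K \<subseteq> G \<longrightarrow>
        uniform_limit K (inner_comp \<phi>) (infinite_comp \<phi>) sequentially) \<and>
     infinite_comp \<phi> holomorphic_on G"

end

theory Submission
  imports Defs
begin

text \<open>
  Fix a closed disk of radius \<open>4s\<close> in \<open>G\<close> and drop the first \<open>m\<close> maps so that the remaining maps
  move points of this disk by less than \<open>s\<close> in total. Then the tail compositions
  \<open>\<phi>\<^sub>m\<^sub>+\<^sub>1 \<circ> \<dots> \<circ> \<phi>\<^sub>n\<close> send the disk of radius \<open>3s\<close> into that of radius \<open>4s\<close>, so for \<open>n \<ge> m\<close> the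
  functions \<open>\<Phi>\<^sub>n\<close> send it into one fixed compact subset of \<open>G\<close>. By Cauchy's inequality they
  are Lipschitz on the disk of radius \<open>2s\<close> with a common constant \<open>L\<close>, whence
  \<open>|\<Phi>\<^sub>n\<^sub>+\<^sub>1(z) - \<Phi>\<^sub>n(z)| = |\<Phi>\<^sub>n(\<phi>\<^sub>n\<^sub>+\<^sub>1(z)) - \<Phi>\<^sub>n(z)| \<le> L |\<phi>\<^sub>n\<^sub>+\<^sub>1(z) - z|\<close> on the disk of radius \<open>s\<close>,
  which is summable. The limit stays in the compact subset, hence in \<open>G\<close>.
\<close>

lemma inner_comp_image_subset:
  assumes "\<And>j. j \<ge> 1 \<Longrightarrow> \<phi> j ` G \<subseteq> G"
  shows "inner_comp \<phi> n ` G \<subseteq> G"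
proof (induction n)
  case (Suc n)
  then show ?case using assms[of "Suc n"] by fastforce
qed simp

lemma inner_comp_holomorphic_on:
  assumes "\<And>j. j \<ge> 1 \<Longrightarrow> \<phi> j holomorphic_on G"
    and "\<And>j. j \<ge> 1 \<Longrightarrow> \<phi> j ` G \<subseteq> G"
  shows "inner_comp \<phi> n holomorphic_on G"
proof (induction n)
  case 0
  then show ?case by (simp add: id_def)
next
  case (Suc n)
  then show ?case
    using holomorphic_on_compose_gen[OF assms(1)[of "Suc n"] Suc assms(2)[of "Suc n"]]
    by (simp only: inner_comp.simps)
qed

text \<open>Every point of the smaller disk is the centre of a disk of radius \<open>s\<close>
  inside the larger one, so Cauchy's inequality gives \<open>norm (deriv f w) \<le> B / s\<close>;
  convexity of the smaller disk turns this into a Lipschitz bound.\<close>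

lemma bounded_holomorphic_lipschitz:
  assumes holf: "f holomorphic_on cball z0 (R + s)" and s: "s > 0"
    and B: "\<And>w. w \<in> cball z0 (R + s) \<Longrightarrow> norm (f w) \<le> B"
    and xy: "x \<in> cball z0 R" "y \<in> cball z0 R"
  shows "norm (f x - f y) \<le> B / s * norm (x - y)"
proof (rule field_differentiable_bound[where S = "cball z0 R" and f' = "deriv f"])
  fix w assume w: "w \<in> cball z0 R"
  have sub: "cball w s \<subseteq> cball z0 (R + s)"
    using w by (intro subsetI) (simp, smt (verit) dist_triangle)
  have hol: "f holomorphic_on cball w s"
    using holf sub holomorphic_on_subset by blast
  have "norm ((deriv ^^ 1) f w) \<le> fact 1 * B / s ^ 1"
  proof (rule Cauchy_inequality)
    show "f holomorphic_on ball w s" using hol ball_subset_cball holomorphic_on_subset by blast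
    show "continuous_on (cball w s) f" using hol by (rule holomorphic_on_imp_continuous_on)
    show "norm (f v) \<le> B" if "norm (w - v) = s" for v
      using that sub B by (auto simp: dist_norm)
  qed (use s in simp)
  then show "norm (deriv f w) \<le> B / s" by simp
  have "f field_differentiable at w"
    using hol s ball_subset_cball holomorphic_on_subset holomorphic_on_imp_differentiable_at
    by (metis open_ball centre_in_ball)
  then show "(f has_field_derivative deriv f w) (at w within cball z0 R)"
    by (simp add: DERIV_deriv_iff_field_differentiable has_field_derivative_at_within)
qed (use xy in auto)

text \<open>Membership in the image under \<open>inner_comp \<phi> m\<close> avoids a separate
  notion of tail composition. The innermost map \<open>\<phi> n\<close> acts first and moves the
  point by at most \<open>e (n - 1)\<close>, exactly the amount by which the allowed distance from
  \<open>z0\<close> grows when that term leaves the sum.\<close>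

lemma inner_comp_in_tail_image:
  assumes "m \<le> n"
    and step: "\<And>j w. m \<le> j \<Longrightarrow> w \<in> cball z0 R \<Longrightarrow> dist w (\<phi> (Suc j) w) \<le> e j"
    and "\<And>j. e j \<ge> 0"
    and "dist z0 w \<le> R - sum e {m..<n}"
  shows "inner_comp \<phi> n w \<in> inner_comp \<phi> m ` cball z0 R"
  using assms(1,4)
proof (induction n arbitrary: w rule: dec_induct)
  case base
  then show ?case by simp
next
  case (step n)
  \<comment> \<open>This puts \<open>w\<close> in \<open>cball z0 R\<close>, where the displacement
    bound is available.\<close>
  have "sum e {m..<Suc n} \<ge> 0" using assms(3) by (simp add: sum_nonneg)
  then have "dist w (\<phi> (Suc n) w) \<le> e n"
    using step assms(2)[of n w] by simp
  moreover have "sum e {m..<Suc n} = sum e {m..<n} + e n" using step by simp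
  ultimately have "dist z0 (\<phi> (Suc n) w) \<le> R - sum e {m..<n}"
    using step.prems dist_triangle[of z0 "\<phi> (Suc n) w" w] by linarith
  then show ?case using step.IH by simp
qed

lemma uniform_limit_infinite_comp_cball:
  assumes hol: "\<And>j. j \<ge> 1 \<Longrightarrow> \<phi> j holomorphic_on G"
    and self: "\<And>j. j \<ge> 1 \<Longrightarrow> \<phi> j ` G \<subseteq> G"
    and s: "s > 0" and sub: "cball z0 (4 * s) \<subseteq> G"
    and sm: "summable (\<lambda>j. SUP z\<in>cball z0 (4 * s). norm (\<phi> (Suc j) z - z))"
  shows "uniform_limit (cball z0 s) (inner_comp \<phi>) (infinite_comp \<phi>) sequentially"
    and "infinite_comp \<phi> ` cball z0 s \<subseteq> G"
proof -
  define e where "e j = (SUP z\<in>cball z0 (4 * s). norm (\<phi> (Suc j) z - z))" for j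
  have step: "norm (\<phi> (Suc j) w - w) \<le> e j" if "w \<in> cball z0 (4 * s)" for j w
    unfolding e_def
  proof (rule cSUP_upper[OF that])
    \<comment> \<open>A real \<open>SUP\<close> is an upper bound only for a set bounded above;
      compactness of the disk supplies this.\<close>
    have "continuous_on (cball z0 (4 * s)) (\<phi> (Suc j))"
      using hol[of "Suc j"] sub
      by (intro holomorphic_on_imp_continuous_on) (auto intro: holomorphic_on_subset)
    then have "compact ((\<lambda>z. norm (\<phi> (Suc j) z - z)) ` cball z0 (4 * s))"
      by (intro compact_continuous_image continuous_intros compact_cball)
    then show "bdd_above ((\<lambda>z. norm (\<phi> (Suc j) z - z)) ` cball z0 (4 * s))"
      by (intro bounded_imp_bdd_above compact_imp_bounded)
  qed
  have e0: "e j \<ge> 0" for j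
    using step[of z0 j] s norm_ge_zero[of "\<phi> (Suc j) z0 - z0"] by (simp del: norm_ge_zero)
  have sme: "summable e" using sm unfolding e_def .
  obtain m where m: "\<And>n. sum e {m..<n} < s"
  proof -
    obtain m where "\<And>n k. n \<ge> m \<Longrightarrow> norm (sum e {n..<k}) < s"
      using sme s unfolding summable_Cauchy by blast
    then show ?thesis using that[of m] by (smt (verit) order_refl real_norm_def)
  qed
  define C where "C = inner_comp \<phi> m ` cball z0 (4 * s)"
  have holI: "inner_comp \<phi> n holomorphic_on G" for n
    by (rule inner_comp_holomorphic_on[OF hol self])
  have compC: "compact C"
    unfolding C_def using holI sub
    by (intro compact_continuous_image compact_cball)
       (meson continuous_on_subset holomorphic_on_imp_continuous_on)
  have CG: "C \<subseteq> G"
    using inner_comp_image_subset[of \<phi> G m, OF self] sub unfolding C_def by blast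
  have inC: "inner_comp \<phi> n w \<in> C" if "m \<le> n" "w \<in> cball z0 (3 * s)" for n w
    unfolding C_def
  proof (rule inner_comp_in_tail_image[where e = e, OF that(1)])
    show "dist z0 w \<le> 4 * s - sum e {m..<n}" using that(2) m[of n] by simp
    show "dist v (\<phi> (Suc j) v) \<le> e j" if "v \<in> cball z0 (4 * s)" for j v
      using step[OF that] by (simp add: dist_norm norm_minus_commute)
  qed (rule e0)
  obtain B where B: "\<And>w. w \<in> C \<Longrightarrow> norm w \<le> B"
    using compact_imp_bounded[OF compC] bounded_iff by blast
  define M where "M n = B / s * e n" for n
  have diff: "norm (inner_comp \<phi> (Suc n) w - inner_comp \<phi> n w) \<le> M n"
    if n: "m \<le> n" and w: "w \<in> cball z0 s" for n w
  proof -
    have "norm (\<phi> (Suc n) w - w) \<le> e n" using step w s by simp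
    \<comment> \<open>A single displacement is one term of a tail sum below \<open>s\<close>, so
      \<open>\<phi> (Suc n)\<close> maps the disk of radius \<open>s\<close> into that of radius
      \<open>2 * s\<close>.\<close>
    moreover have "e n < s"
    proof -
      have "sum e {n} \<le> sum e {m..<Suc n}"
        using n e0 by (intro sum_mono2) auto
      then show ?thesis using m[of "Suc n"] by simp
    qed
    ultimately have \<phi>w: "\<phi> (Suc n) w \<in> cball z0 (2 * s)"
      using w dist_triangle[of z0 "\<phi> (Suc n) w" w] by (simp add: dist_norm norm_minus_commute)
    \<comment> \<open>Cauchy's inequality needs a margin \<open>s\<close> around the disk of radius
      \<open>2 * s\<close>; on the resulting disk of radius \<open>3 * s\<close>, \<open>inC\<close>
      gives the bound \<open>B\<close>.\<close>
    have "cball z0 (2 * s + s) \<subseteq> G"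
      using sub s subset_cball[of "2 * s + s" "4 * s" z0] by auto
    then have "inner_comp \<phi> n holomorphic_on cball z0 (2 * s + s)"
      using holI holomorphic_on_subset by blast
    then have "norm (inner_comp \<phi> n (\<phi> (Suc n) w) - inner_comp \<phi> n w)
        \<le> B / s * norm (\<phi> (Suc n) w - w)"
      using s \<phi>w w inC[OF n]
      by (intro bounded_holomorphic_lipschitz[of _ z0 "2 * s"] B) auto
    also have "\<dots> \<le> M n"
    proof -
      have "inner_comp \<phi> n w \<in> C" using inC[OF n] w s by simp
      then have "B \<ge> 0" using B norm_ge_zero order_trans by blast
      then show ?thesis unfolding M_def using step[of w n] w s
        by (intro mult_left_mono) auto
    qed
    finally show ?thesis by simp
  qed
  \<comment> \<open>The sum telescopes to \<open>inner_comp \<phi> n z - z\<close>, since the empty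
    composition is the identity; hence the added \<open>z\<close>.\<close>
  define l where "l z = (\<Sum>i. inner_comp \<phi> (Suc i) z - inner_comp \<phi> i z) + z" for z
  have "uniform_limit (cball z0 s)
      (\<lambda>n z. \<Sum>i<n. inner_comp \<phi> (Suc i) z - inner_comp \<phi> i z)
      (\<lambda>z. \<Sum>i. inner_comp \<phi> (Suc i) z - inner_comp \<phi> i z) sequentially"
  \<comment> \<open>The majorant is known only from index \<open>m\<close> on, hence the eventual
    form of the test.\<close>
  proof (rule Weierstrass_m_test_ev)
    show "\<forall>\<^sub>F n in sequentially. \<forall>z\<in>cball z0 s.
        norm (inner_comp \<phi> (Suc n) z - inner_comp \<phi> n z) \<le> M n"
      using diff unfolding eventually_sequentially by blast
    show "summable M" unfolding M_def using sme by (rule summable_mult)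
  qed
  then have "uniform_limit (cball z0 s)
      (\<lambda>n z. (\<Sum>i<n. inner_comp \<phi> (Suc i) z - inner_comp \<phi> i z) + z) l sequentially"
    unfolding l_def by (intro uniform_limit_add uniform_limit_const)
  moreover have "(\<Sum>i<n. inner_comp \<phi> (Suc i) z - inner_comp \<phi> i z) + z = inner_comp \<phi> n z" for n z
    by (subst sum_lessThan_telescope) simp
  ultimately have lim_l: "uniform_limit (cball z0 s) (inner_comp \<phi>) l sequentially"
    by (simp only:)
  have l: "infinite_comp \<phi> z = l z" if "z \<in> cball z0 s" for z
    unfolding infinite_comp_def
    using tendsto_uniform_limitI[OF lim_l that] by (rule limI)
  show ul: "uniform_limit (cball z0 s) (inner_comp \<phi>) (infinite_comp \<phi>) sequentially"
    using lim_l l uniform_limit_cong'[of "cball z0 s" "inner_comp \<phi>" "inner_comp \<phi>" "infinite_comp \<phi>" l sequentially]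
    by blast
  show "infinite_comp \<phi> ` cball z0 s \<subseteq> G"
  proof
    fix w assume "w \<in> infinite_comp \<phi> ` cball z0 s"
    then obtain z where z: "z \<in> cball z0 s" "w = infinite_comp \<phi> z" by blast
    \<comment> \<open>A limit of points of the open set \<open>G\<close> could lie on its boundary;
      the closed set \<open>C\<close> excludes this.\<close>
    have "infinite_comp \<phi> z \<in> C"
    proof (rule Lim_in_closed_set)
      show "closed C" using compC by (rule compact_imp_closed)
      show "\<forall>\<^sub>F n in sequentially. inner_comp \<phi> n z \<in> C"
        using inC[of _ z] z(1) s by (intro eventually_sequentiallyI[of m]) auto
    qed (use tendsto_uniform_limitI[OF ul z(1)] in auto)
    then show "w \<in> G" using CG z by blast
  qed
qed

theorem theorem3p2:
  fixes G :: "complex set" and \<phi> :: "nat \<Rightarrow> complex \<Rightarrow> complex"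
  assumes "open G"
    and "\<And>j. j \<ge> 1 \<Longrightarrow> \<phi> j holomorphic_on G"
    and "\<And>j. j \<ge> 1 \<Longrightarrow> \<phi> j ` G \<subseteq> G"
    and "\<And>z0 P. P > 0 \<Longrightarrow> cball z0 P \<subseteq> G \<Longrightarrow>
           summable (\<lambda>j. SUP z\<in>cball z0 P. norm (\<phi> (Suc j) z - z))"
  shows "infinite_comp_holomorphic_on \<phi> G \<and> infinite_comp \<phi> ` G \<subseteq> G"
proof -
  have "\<exists>s>0. cball z s \<subseteq> G \<and>
      uniform_limit (cball z s) (inner_comp \<phi>) (infinite_comp \<phi>) sequentially \<and>
      infinite_comp \<phi> ` cball z s \<subseteq> G" if z: "z \<in> G" for z
  proof -
    obtain r where r: "r > 0" "cball z r \<subseteq> G"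
      using assms(1) z open_contains_cball by blast
    define s where "s = r / 4"
    have s: "s > 0" "cball z (4 * s) \<subseteq> G" using r by (auto simp: s_def)
    have "cball z s \<subseteq> G" using s subset_cball[of s "4 * s" z] by auto
    then show ?thesis
      using uniform_limit_infinite_comp_cball[OF assms(2,3) s assms(4)] s by auto
  qed
  then obtain s where s: "\<And>z. z \<in> G \<Longrightarrow> s z > 0" "\<And>z. z \<in> G \<Longrightarrow> cball z (s z) \<subseteq> G"
    "\<And>z. z \<in> G \<Longrightarrow> uniform_limit (cball z (s z)) (inner_comp \<phi>) (infinite_comp \<phi>) sequentially"
    "\<And>z. z \<in> G \<Longrightarrow> infinite_comp \<phi> ` cball z (s z) \<subseteq> G"
    by metis
  have "uniform_limit K (inner_comp \<phi>) (infinite_comp \<phi>) sequentially"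
    if K: "compact K" "K \<subseteq> G" for K
  proof -
    \<comment> \<open>Open balls give the finite subcover; uniform convergence on the finitely many
      closed balls then passes to their union.\<close>
    have "K \<subseteq> (\<Union>z\<in>K. ball z (s z))" using s(1) K(2) by force
    then obtain F where F: "F \<subseteq> K" "finite F" "K \<subseteq> (\<Union>z\<in>F. ball z (s z))"
      using compactE_image[OF K(1), of K "\<lambda>z. ball z (s z)"] by auto
    have "uniform_limit (\<Union>z\<in>F. cball z (s z)) (inner_comp \<phi>) (infinite_comp \<phi>) sequentially"
      using F(1,2) K(2) s(3) by (intro uniform_limit_on_UNION) auto
    then show ?thesis
      by (rule uniform_limit_on_subset) (use F(3) ball_subset_cball in blast)
  qed
  moreover have "infinite_comp \<phi> holomorphic_on G"
  proof (rule holomorphic_uniform_sequence[OF assms(1)])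
    show "inner_comp \<phi> n holomorphic_on G" for n
      by (rule inner_comp_holomorphic_on[OF assms(2,3)])
    show "\<exists>d>0. cball z d \<subseteq> G \<and>
        uniform_limit (cball z d) (inner_comp \<phi>) (infinite_comp \<phi>) sequentially"
      if "z \<in> G" for z
      using s(1-3)[OF that] by blast
  qed
  moreover have "infinite_comp \<phi> ` G \<subseteq> G"
  proof
    fix w assume "w \<in> infinite_comp \<phi> ` G"
    then obtain z where z: "z \<in> G" "w = infinite_comp \<phi> z" by blast
    moreover have "z \<in> cball z (s z)" using s(1)[OF z(1)] by simp
    ultimately show "w \<in> G" using s(4)[OF z(1)] by blast
  qed
  ultimately show ?thesis unfolding infinite_comp_holomorphic_on_def by blast
qed

end
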